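(* For all integers $i,j,k \ge 0$, $$P^{(k)}_{i,j} = P^{(j)}_{i,k}.$$
   Context: The Pascal array is the infinite array $P=(P_{i,j})_{i,j\ge 0}$ with $P_{i,j}=\binom{i+j}{i}$. For $k\ge 1$ and $i,j\ge 0$, $P^{(k)}_{i,j}$ denotes the determinant of the $k\times k$ contiguous subarray of $P$ with top-left corner at $(i,j)$: $$P^{(k)}_{i,j}=\det\big(P_{i+a,\,j+b}\big)_{0\le a,b\le k-1}.$$ For $k=0$ the convention is $P^{(0)}_{i,j}=1$ for all $i,j\ge 0$. *)

theory Defs
  imports "Jordan_Normal_Form.Determinant"
begin

definition pascal :: "nat \<Rightarrow> nat \<Rightarrow> int" where
  "pascal i j = int ((i + j) choose i)"

definition pascal_minor :: "nat \<Rightarrow> nat \<Rightarrow> nat \<Rightarrow> int" where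
  "pascal_minor k i j = det (mat k k (\<lambda>(a, b). pascal (i + a) (j + b)))"

(* The determinant of the empty matrix is 1, which gives the convention for k = 0. *)
lemma pascal_minor_0 [simp]: "pascal_minor 0 i j = 1"
  by (simp add: pascal_minor_def)

end

theory Submission
  imports Defs
begin

text \<open>Clearing denominators, \<open>(i+a)! (j+b)! P\<^bsub>i+a,j+b\<^esub> = (i+j+a)! b! C(i+j+a+b, b)\<close>,
  and by Vandermonde's convolution the matrix of the last factor is a product of two unitriangular
  matrices, hence has determinant 1.  With the superfactorial \<open>H n = 0! 1! \<dots> (n-1)!\<close> this gives
  \<open>P\<^bsup>(k)\<^esup>\<^bsub>i,j\<^esub> = H i H j H k H (i+j+k) / (H (i+j) H (i+k) H (j+k))\<close>
  (MacMahon's box formula), which is symmetric in \<open>i, j, k\<close>.\<close>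

text \<open>Scaling rows is left multiplication by a diagonal matrix and scaling columns is right
  multiplication by one, so multiplicativity of \<open>det\<close> applies.\<close>

lemma det_mat_scale_rows_cols:
  fixes f h :: "nat \<Rightarrow> 'a :: idom"
  shows "det (mat n n (\<lambda>(a, b). f a * g a b * h b))
    = prod f {..<n} * det (mat n n (\<lambda>(a, b). g a b)) * prod h {..<n}"
proof -
  have diag: "det (mat_diag n d) = prod d {..<n}" for d :: "nat \<Rightarrow> 'a"
    by (subst det_upper_triangular[of _ n])
      (auto simp: mat_diag_def prod_list_diag_prod atLeast0LessThan)
  have "mat n n (\<lambda>(a, b). f a * g a b * h b)
      = mat_diag n f * mat n n (\<lambda>(a, b). g a b) * mat_diag n h"
    by (subst mat_diag_mult_left[of _ n n], simp, subst mat_diag_mult_right[of _ n n]) auto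
  then show ?thesis
    by (simp add: det_mult[of _ n] mult_carrier_mat[of _ n n] diag)
qed

text \<open>Vandermonde for \<open>(a + (s + b)) choose (s + a)\<close>, with the summation index
  reversed. Padding the range with zero terms up to \<open>n\<close> makes it independent of
  \<open>a\<close>, so that the sum is an entry of a matrix product.\<close>

lemma choose_add_eq_sum:
  fixes s a b n :: nat
  assumes "a < n"
  shows "(s + a + b) choose b = (\<Sum>m<n. (a choose m) * ((s + b) choose (s + m)))"
proof -
  have "(s + a + b) choose b = (a + (s + b)) choose (s + a)"
    using binomial_symmetric[of b "s + a + b"] by (simp add: add_ac)
  also have "\<dots> = (\<Sum>r\<le>s + a. (a choose r) * ((s + b) choose (s + a - r)))"
    by (rule vandermonde[symmetric])
  also have "\<dots> = (\<Sum>r\<le>a. (a choose r) * ((s + b) choose (s + a - r)))"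
    by (rule sum.mono_neutral_right) auto
  also have "\<dots> = (\<Sum>m\<le>a. (a choose m) * ((s + b) choose (s + m)))"
  proof (rule sum.reindex_bij_witness[of _ "\<lambda>m. a - m" "\<lambda>m. a - m"])
    fix r assume "r \<in> {..a}"
    then have "a choose (a - r) = a choose r" "s + (a - r) = s + a - r"
      using binomial_symmetric[of r a] by simp_all
    then show "(a choose (a - r)) * ((s + b) choose (s + (a - r)))
        = (a choose r) * ((s + b) choose (s + a - r))"
      by simp
  qed auto
  also have "\<dots> = (\<Sum>m<n. (a choose m) * ((s + b) choose (s + m)))"
    using assms by (intro sum.mono_neutral_left) auto
  finally show ?thesis .
qed

lemma det_choose_add:
  "det (mat n n (\<lambda>(a, b). int ((s + a + b) choose b))) = 1"
proof -
  \<comment> \<open>Both are triangular with unit diagonal: \<open>a choose m\<close> vanishes for m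
    > a, and \<open>(s + b) choose (s + m)\<close> for m > b.\<close>
  define L where "L = mat n n (\<lambda>(a, m). int (a choose m))"
  define U where "U = mat n n (\<lambda>(m, b). int ((s + b) choose (s + m)))"
  have [simp]: "L \<in> carrier_mat n n" "U \<in> carrier_mat n n"
    by (simp_all add: L_def U_def)
  have "mat n n (\<lambda>(a, b). int ((s + a + b) choose b)) = L * U"
  proof (rule eq_matI)
    fix a b assume "a < dim_row (L * U)" "b < dim_col (L * U)"
    then have ab: "a < n" "b < n"
      by (simp_all add: L_def U_def)
    then have "(L * U) $$ (a, b) = (\<Sum>m<n. int (a choose m) * int ((s + b) choose (s + m)))"
      by (simp add: L_def U_def scalar_prod_def atLeast0LessThan)
    also have "\<dots> = int ((s + a + b) choose b)"
      by (subst choose_add_eq_sum[OF ab(1)]) simp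
    finally show "mat n n (\<lambda>(a, b). int ((s + a + b) choose b)) $$ (a, b) = (L * U) $$ (a, b)"
      using ab by simp
  qed (simp_all add: L_def U_def)
  moreover have "det L = 1"
    by (subst det_lower_triangular[of n]) (auto simp: L_def prod_list_diag_prod)
  moreover have "det U = 1"
    by (subst det_upper_triangular[of _ n]) (auto simp: U_def prod_list_diag_prod)
  ultimately show ?thesis
    by (simp add: det_mult[of _ n])
qed

text \<open>Both sides equal (i+j+a+b)!. On the right the factorials depend on the row or the column
  alone, and the binomial has the form in \<open>det_choose_add\<close> with s = i + j.\<close>

lemma fact_mult_pascal:
  "fact (i + a) * pascal (i + a) (j + b) * fact (j + b)
    = fact (i + j + a) * int ((i + j + a + b) choose b) * fact b"
proof -
  have "fact (i + a) * fact (j + b) * ((i + a + (j + b)) choose (i + a)) = (fact (i + a + (j + b)) :: nat)"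
    using binomial_fact_lemma[of "i + a" "i + a + (j + b)"] by simp
  moreover have "fact b * fact (i + j + a) * ((i + j + a + b) choose b) = (fact (i + j + a + b) :: nat)"
    using binomial_fact_lemma[of b "i + j + a + b"] by simp
  ultimately have "fact (i + a) * ((i + a + (j + b)) choose (i + a)) * fact (j + b)
      = fact (i + j + a) * ((i + j + a + b) choose b) * (fact b :: nat)"
    by (simp add: algebra_simps)
  from arg_cong[OF this, of int] show ?thesis
    by (simp add: pascal_def add_ac)
qed

definition superfact :: "nat \<Rightarrow> int" where
  "superfact n = (\<Prod>a<n. fact a)"

lemma superfact_nonzero: "superfact n \<noteq> 0"
  by (simp add: superfact_def)

lemma superfact_add: "superfact (m + n) = superfact m * (\<Prod>a<n. fact (m + a))"
  by (induction n) (simp_all add: superfact_def)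

lemma pascal_minor_superfact:
  "superfact (i + k) * superfact (j + k) * superfact (i + j) * pascal_minor k i j
    = superfact i * superfact j * superfact k * superfact (i + j + k)"
proof -
  have "(\<Prod>a<k. fact (i + a)) * pascal_minor k i j * (\<Prod>b<k. fact (j + b))
      = det (mat k k (\<lambda>(a, b). fact (i + a) * pascal (i + a) (j + b) * fact (j + b)))"
    by (simp add: pascal_minor_def det_mat_scale_rows_cols)
  also have "\<dots> = (\<Prod>a<k. fact (i + j + a)) * superfact k"
    by (simp add: fact_mult_pascal det_mat_scale_rows_cols det_choose_add superfact_def)
  finally show ?thesis
    \<comment> \<open>Splitting these three superfactorials exposes exactly the shifted factorial
      products of the determinant identity.\<close>
    unfolding superfact_add[of i k] superfact_add[of j k] superfact_add[of "i + j" k]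
    by (simp add: mult_ac)
qed

theorem mainTheorem1:
  fixes i j k :: nat
  shows "pascal_minor k i j = pascal_minor j i k"
proof -
  \<comment> \<open>Exchanging j and k only permutes the factors of \<open>?c\<close> and of the
    right-hand side of \<open>pascal_minor_superfact\<close>; the nonzero \<open>?c\<close> then
    cancels.\<close>
  let ?c = "superfact (i + j) * superfact (i + k) * superfact (j + k)"
  have "?c * pascal_minor k i j = ?c * pascal_minor j i k"
    using pascal_minor_superfact[of i k j] pascal_minor_superfact[of i j k]
    by (simp add: ac_simps)
  then show ?thesis
    by (simp add: superfact_nonzero)
qed

end
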